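(* Let $0<q<1$, $l>0$, $\psi\in\mathbb R$, and $\theta\in\mathbb C$, and put $\lambda=-\frac{2q^{1/2}\cosh\theta}{1-q}$. The eigenfunction, $I_4^{(\psi)}\eta^l_\lambda=\lambda\,\eta^l_\lambda$, of the operator $$I_4^{(\psi)}=q^{-J_0/4}\bigl(e^{\mathrm i\psi}J_++e^{-\mathrm i\psi}J_-\bigr)q^{-J_0/4}$$ is $$\eta^l_\lambda(x;q)=\frac{(e^{\mathrm i\psi}q^{(2l+3)/4}e^{\theta}x;q)_\infty\,(e^{\mathrm i\psi}q^{(2l+3)/4}e^{-\theta}x;q)_\infty}{(\mathrm i\,e^{\mathrm i\psi}q^{(3-2l)/4}x;q)_\infty\,(-\mathrm i\,e^{\mathrm i\psi}q^{(3-2l)/4}x;q)_\infty}.$$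
   Context: Notation: $(a;q)_n=\prod_{r=0}^{n-1}(1-aq^r)$, $(a;q)_\infty=\prod_{r\ge0}(1-aq^r)$, $[c]_q=\frac{q^{c/2}-q^{-c/2}}{q^{1/2}-q^{-1/2}}$. Discrete series representation $T_l^+$ of $U_q(\mathrm{su}_{1,1})$ ($l>0$): $\mathcal H_l$ is the Hilbert space with orthonormal basis the monomials $f^l_n(x;q)=c^l_n(q)x^n$, $n=0,1,2,\dots$, where $c^l_n(q)=q^{(1-2l)n/4}\left(\frac{(q^{2l};q)_n}{(q;q)_n}\right)^{1/2}$. The operators act by $J_0f^l_n=(l+n)f^l_n$, $J_+f^l_n=\sqrt{[2l+n]_q[n+1]_q}\,f^l_{n+1}$, $J_-f^l_n=\sqrt{[2l+n-1]_q[n]_q}\,f^l_{n-1}$, and $q^{cJ_0}f^l_n=q^{c(l+n)}f^l_n$. The operator $I_4^{(\psi)}$ is tridiagonal in this basis and hence acts coefficientwise on formal power series $\sum_na_nf^l_n$; the eigenvalue equation is understood for this action, the eigenfunction being determined up to a constant factor and normalized to have value $1$ at $x=0$. *)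

theory Defs
  imports "HOL-Analysis.Analysis"
begin

definition qpoch :: "real \<Rightarrow> real \<Rightarrow> nat \<Rightarrow> real" where
  "qpoch a q n = (\<Prod>r<n. 1 - a * q ^ r)"

definition qpoch_inf :: "complex \<Rightarrow> real \<Rightarrow> complex" where
  "qpoch_inf a q = (\<Prod>r. 1 - a * complex_of_real q ^ r)"

definition qnum :: "real \<Rightarrow> real \<Rightarrow> real" where
  "qnum q c = (q powr (c / 2) - q powr (- c / 2)) / (q powr (1 / 2) - q powr (- 1 / 2))"

definition basis_coeff :: "real \<Rightarrow> real \<Rightarrow> nat \<Rightarrow> real" where
  "basis_coeff l q n =
     q powr ((1 - 2 * l) * real n / 4) * sqrt (qpoch (q powr (2 * l)) q n / qpoch q q n)"

definition basis_fps :: "real \<Rightarrow> real \<Rightarrow> nat \<Rightarrow> complex fps" where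
  "basis_fps l q n = fps_const (complex_of_real (basis_coeff l q n)) * fps_X ^ n"

text \<open>
  The coefficient \<open>a\<^sub>n\<close> in the expansion \<open>F = (\<Sum>n. a\<^sub>n f\<^sub>n)\<close> of a formal power series.
\<close>

definition basis_coord :: "real \<Rightarrow> real \<Rightarrow> complex fps \<Rightarrow> nat \<Rightarrow> complex" where
  "basis_coord l q F n = fps_nth F n / complex_of_real (basis_coeff l q n)"

text \<open>
  The coefficientwise extension, to all formal power series, of an operator prescribed on the
  basis by \<open>f\<^sub>n \<mapsto> \<phi> n\<close>: it maps \<open>\<Sum>n. a\<^sub>n f\<^sub>n\<close> to \<open>\<Sum>n. a\<^sub>n \<phi> n\<close>.  It is meaningful when each power of
  \<open>x\<close> occurs in only finitely many \<open>\<phi> n\<close>, which holds for all operators below (for these,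
  \<open>\<phi> n\<close> is a multiple of a single basis element \<open>f\<^sub>m\<close> with \<open>m\<close> in \<open>{n - 1, n, n + 1}\<close>).
\<close>

definition formal_ext ::
    "real \<Rightarrow> real \<Rightarrow> (nat \<Rightarrow> complex fps) \<Rightarrow> complex fps \<Rightarrow> complex fps" where
  "formal_ext l q \<phi> F =
     Abs_fps (\<lambda>m. \<Sum>n | fps_nth (\<phi> n) m \<noteq> 0. basis_coord l q F n * fps_nth (\<phi> n) m)"

definition J_plus :: "real \<Rightarrow> real \<Rightarrow> complex fps \<Rightarrow> complex fps" where
  "J_plus l q = formal_ext l q (\<lambda>n.
     fps_const (complex_of_real (sqrt (qnum q (2 * l + real n) * qnum q (real n + 1))))
       * basis_fps l q (n + 1))"

text \<open>
  For \<open>n = 0\<close> the scalar factor vanishes, so the truncated index \<open>n - 1\<close> is harmless there.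
\<close>

definition J_minus :: "real \<Rightarrow> real \<Rightarrow> complex fps \<Rightarrow> complex fps" where
  "J_minus l q = formal_ext l q (\<lambda>n.
     fps_const (complex_of_real (sqrt (qnum q (2 * l + real n - 1) * qnum q (real n))))
       * basis_fps l q (n - 1))"

text \<open>The operator \<open>q\<close> to the power \<open>c J\<^sub>0\<close>.\<close>

definition q_pow_J0 :: "real \<Rightarrow> real \<Rightarrow> real \<Rightarrow> complex fps \<Rightarrow> complex fps" where
  "q_pow_J0 l q c = formal_ext l q (\<lambda>n.
     fps_const (complex_of_real (q powr (c * (l + real n)))) * basis_fps l q n)"

definition I4 :: "real \<Rightarrow> real \<Rightarrow> real \<Rightarrow> complex fps \<Rightarrow> complex fps" where
  "I4 l q \<psi> F =
     (let G = q_pow_J0 l q (- 1 / 4) F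
      in q_pow_J0 l q (- 1 / 4)
           (fps_const (exp (\<i> * complex_of_real \<psi>)) * J_plus l q G
          + fps_const (exp (- \<i> * complex_of_real \<psi>)) * J_minus l q G))"

definition eta :: "real \<Rightarrow> real \<Rightarrow> real \<Rightarrow> complex \<Rightarrow> complex \<Rightarrow> complex" where
  "eta l q \<psi> \<theta> x =
     (qpoch_inf (exp (\<i> * complex_of_real \<psi>) * complex_of_real (q powr ((2 * l + 3) / 4)) * exp \<theta> * x) q
      * qpoch_inf (exp (\<i> * complex_of_real \<psi>) * complex_of_real (q powr ((2 * l + 3) / 4)) * exp (- \<theta>) * x) q)
     / (qpoch_inf (\<i> * exp (\<i> * complex_of_real \<psi>) * complex_of_real (q powr ((3 - 2 * l) / 4)) * x) q
      * qpoch_inf (- \<i> * exp (\<i> * complex_of_real \<psi>) * complex_of_real (q powr ((3 - 2 * l) / 4)) * x) q)"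

lemma basis_coeff_pos:
  assumes "0 < q" "q < 1" "0 < l"
  shows "basis_coeff l q n > 0"
proof -
  have a: "q powr (2 * l) < 1" using assms by (simp add: powr_def mult_pos_neg)
  have pow: "q ^ r \<le> 1" for r using assms by (simp add: power_le_one)
  have "qpoch (q powr (2 * l)) q n > 0"
    unfolding qpoch_def
  proof (rule prod_pos)
    fix r
    have "q powr (2 * l) * q ^ r \<le> q powr (2 * l) * 1"
      using pow[of r] by (intro mult_left_mono) auto
    then show "0 < 1 - q powr (2 * l) * q ^ r" using a by linarith
  qed
  moreover have "qpoch q q n > 0"
    unfolding qpoch_def
  proof (rule prod_pos)
    fix r
    have "q * q ^ r \<le> q * 1" using pow[of r] assms by (intro mult_left_mono) auto
    then show "0 < 1 - q * q ^ r" using assms by linarith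
  qed
  ultimately show ?thesis using assms by (simp add: basis_coeff_def)
qed

lemma basis_fps_nth:
  "fps_nth (basis_fps l q n) m = (if m = n then complex_of_real (basis_coeff l q n) else 0)"
  by (simp add: basis_fps_def fps_X_power_iff)

lemma basis_coord_basis_fps:
  assumes "0 < q" "q < 1" "0 < l"
  shows "basis_coord l q (basis_fps l q n) m = (if m = n then 1 else 0)"
  using basis_coeff_pos[OF assms, of n] by (auto simp: basis_coord_def basis_fps_nth)

lemma formal_ext_basis_fps:
  assumes "0 < q" "q < 1" "0 < l" and fin: "\<And>m. finite {n. fps_nth (\<phi> n) m \<noteq> 0}"
  shows "formal_ext l q \<phi> (basis_fps l q k) = \<phi> k"
proof (rule fps_ext)
  fix m
  have "fps_nth (formal_ext l q \<phi> (basis_fps l q k)) m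
      = (\<Sum>n | fps_nth (\<phi> n) m \<noteq> 0. if n = k then fps_nth (\<phi> n) m else 0)"
    by (auto simp: formal_ext_def basis_coord_basis_fps[OF assms(1-3)] intro!: sum.cong)
  also have "\<dots> = fps_nth (\<phi> k) m"
    using fin[of m] by (simp add: sum.delta)
  finally show "fps_nth (formal_ext l q \<phi> (basis_fps l q k)) m = fps_nth (\<phi> k) m" .
qed

lemma J_plus_basis_fps:
  assumes "0 < q" "q < 1" "0 < l"
  shows "J_plus l q (basis_fps l q n) =
    fps_const (complex_of_real (sqrt (qnum q (2 * l + real n) * qnum q (real n + 1))))
      * basis_fps l q (n + 1)"
  unfolding J_plus_def
proof (rule formal_ext_basis_fps[OF assms])
  fix m
  show "finite {n. fps_nth (fps_const (complex_of_real
      (sqrt (qnum q (2 * l + real n) * qnum q (real n + 1)))) * basis_fps l q (n + 1)) m \<noteq> 0}"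
    by (rule finite_subset[of _ "{..m}"]) (auto simp: basis_fps_nth split: if_splits)
qed

lemma J_minus_basis_fps:
  assumes "0 < q" "q < 1" "0 < l"
  shows "J_minus l q (basis_fps l q n) =
    fps_const (complex_of_real (sqrt (qnum q (2 * l + real n - 1) * qnum q (real n))))
      * basis_fps l q (n - 1)"
  unfolding J_minus_def
proof (rule formal_ext_basis_fps[OF assms])
  fix m
  show "finite {n. fps_nth (fps_const (complex_of_real
      (sqrt (qnum q (2 * l + real n - 1) * qnum q (real n)))) * basis_fps l q (n - 1)) m \<noteq> 0}"
    by (rule finite_subset[of _ "{..m + 1}"]) (auto simp: basis_fps_nth split: if_splits)
qed

lemma q_pow_J0_basis_fps:
  assumes "0 < q" "q < 1" "0 < l"
  shows "q_pow_J0 l q c (basis_fps l q n) =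
    fps_const (complex_of_real (q powr (c * (l + real n)))) * basis_fps l q n"
  unfolding q_pow_J0_def
proof (rule formal_ext_basis_fps[OF assms])
  fix m
  show "finite {n. fps_nth (fps_const (complex_of_real (q powr (c * (l + real n))))
      * basis_fps l q n) m \<noteq> 0}"
    by (rule finite_subset[of _ "{..m}"]) (auto simp: basis_fps_nth split: if_splits)
qed

end

theory Submission
  imports Defs "HOL-Complex_Analysis.Laurent_Convergence"
begin

text \<open>
  On power series \<open>\<Sum>F\<^sub>n x\<^sup>n\<close> the eigenvalue equation is a three-term recurrence which determines
  \<open>F\<^sub>1, F\<^sub>2, \<dots>\<close> from \<open>F\<^sub>0\<close>.  Since \<open>(x;q)\<^sub>\<infinity> = (1 - x) (q x;q)\<^sub>\<infinity>\<close>, the quotient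
  \<open>f(x) = (a x;q)\<^sub>\<infinity> (b x;q)\<^sub>\<infinity> / ((c x;q)\<^sub>\<infinity> (d x;q)\<^sub>\<infinity>)\<close> satisfies
  \<open>(1 - c x) (1 - d x) f(x) = (1 - a x) (1 - b x) f(q x)\<close>; comparing coefficients gives the same
  recurrence for the parameters at hand.
\<close>


section \<open>The infinite q-Pochhammer symbol as an entire function, and its functional
  equation\<close>

lemma convergent_prod_qpoch_inf:
  assumes "0 < q" "q < 1"
  shows "convergent_prod (\<lambda>r. 1 - x * complex_of_real q ^ r)"
  using assms
  by (intro abs_convergent_prod_imp_convergent_prod summable_imp_abs_convergent_prod)
     (auto simp: norm_mult norm_power intro!: summable_mult summable_geometric)

text \<open>On the disc of radius R the r-th factor differs from 1 by at most
  \<open>R * q ^ r\<close>, so the Weierstrass test applies to the product. Uniformity on every disc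
  is what makes the limit holomorphic.\<close>

lemma uniform_limit_qpoch_inf:
  assumes "0 < q" "q < 1"
  shows "uniform_limit (cball 0 R) (\<lambda>N x. \<Prod>r<N. 1 - x * complex_of_real q ^ r)
           (\<lambda>x. qpoch_inf x q) sequentially"
proof -
  let ?P = "\<lambda>N x. \<Prod>r<N. 1 - x * complex_of_real q ^ r"
  have "uniformly_convergent_on (cball 0 R) ?P"
  proof (rule uniformly_convergent_on_prod')
    show "uniformly_convergent_on (cball 0 R)
            (\<lambda>N x. \<Sum>r<N. norm (1 - x * complex_of_real q ^ r - 1))"
    proof (rule Weierstrass_m_test')
      show "summable (\<lambda>r. R * q ^ r)"
        using assms by (intro summable_mult summable_geometric) auto
    qed (use assms in \<open>auto simp: norm_mult norm_power intro!: mult_right_mono\<close>)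
  qed (auto intro!: continuous_intros)
  then obtain g where g: "uniform_limit (cball 0 R) ?P g sequentially"
    by (auto simp: uniformly_convergent_on_def)
  \<comment> \<open>The M-test only yields some limit \<open>g\<close>. It equals
    \<open>qpoch_inf\<close> pointwise; the shift to \<open>Suc N\<close> is there because the
    standard limit of an infinite product uses partial products over \<open>{..N}\<close>.\<close>
  also have "?this \<longleftrightarrow> uniform_limit (cball 0 R) ?P (\<lambda>x. qpoch_inf x q) sequentially"
  proof (intro uniform_limit_cong)
    fix x :: complex assume "x \<in> cball 0 R"
    with g have "(\<lambda>N. ?P (Suc N) x) \<longlonglongrightarrow> g x"
      by (intro LIMSEQ_Suc tendsto_uniform_limitI)
    moreover have "(\<lambda>N. ?P (Suc N) x) \<longlonglongrightarrow> qpoch_inf x q"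
      using convergent_prod_LIMSEQ[OF convergent_prod_qpoch_inf[OF assms, of x]]
      unfolding lessThan_Suc_atMost qpoch_inf_def .
    ultimately show "g x = qpoch_inf x q"
      by (rule LIMSEQ_unique)
  qed auto
  finally show "uniform_limit (cball 0 R) ?P (\<lambda>x. qpoch_inf x q) sequentially" .
qed

lemma holomorphic_qpoch_inf:
  assumes "0 < q" "q < 1"
  shows "(\<lambda>x. qpoch_inf x q) holomorphic_on UNIV"
proof (rule holomorphic_uniform_sequence)
  fix z :: complex
  have "uniform_limit (cball z 1) (\<lambda>N x. \<Prod>r<N. 1 - x * complex_of_real q ^ r)
          (\<lambda>x. qpoch_inf x q) sequentially"
    by (rule uniform_limit_on_subset[OF uniform_limit_qpoch_inf[OF assms, of "norm z + 1"]])
       (simp add: cball_subset_cball_iff)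
  then show "\<exists>d>0. cball z d \<subseteq> UNIV \<and>
      uniform_limit (cball z d) (\<lambda>N x. \<Prod>r<N. 1 - x * complex_of_real q ^ r)
        (\<lambda>x. qpoch_inf x q) sequentially"
    by (intro exI[of _ 1]) auto
qed (auto intro!: holomorphic_intros)

lemma qpoch_inf_0: "qpoch_inf 0 q = 1"
  by (simp add: qpoch_inf_def)

text \<open>Split off the factor with r = 0; in the remaining product one power of q is absorbed
  into the argument.\<close>

lemma qpoch_inf_shift:
  assumes "0 < q" "q < 1"
  shows "qpoch_inf x q = (1 - x) * qpoch_inf (complex_of_real q * x) q"
proof -
  have "(\<lambda>r. 1 - x * complex_of_real q ^ r) has_prod
      ((\<Prod>k<1. 1 - x * complex_of_real q ^ k) * (\<Prod>k. 1 - x * complex_of_real q ^ (k + 1)))"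
    by (rule has_prod_ignore_initial_segment'[OF convergent_prod_qpoch_inf[OF assms]])
  then show ?thesis
    by (simp add: qpoch_inf_def has_prod_iff mult_ac)
qed

lemma qpoch_inf_analytic:
  assumes "0 < q" "q < 1"
  shows "(\<lambda>x. qpoch_inf (c * x) q) analytic_on S"
proof -
  have "((\<lambda>x. qpoch_inf x q) \<circ> (\<lambda>x. c * x)) holomorphic_on UNIV"
    by (rule holomorphic_on_compose_gen[OF _ holomorphic_qpoch_inf[OF assms]])
       (auto intro!: holomorphic_intros)
  then have "(\<lambda>x. qpoch_inf (c * x) q) analytic_on UNIV"
    by (simp add: o_def analytic_on_open)
  then show ?thesis
    by (rule analytic_on_subset) simp
qed

section \<open>Coefficients of the operators applied to an arbitrary formal power series\<close>

lemma formal_ext_nth_single: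
  assumes "\<And>n. fps_nth (\<phi> n) m \<noteq> 0 \<Longrightarrow> n = k"
  shows "fps_nth (formal_ext l q \<phi> F) m = basis_coord l q F k * fps_nth (\<phi> k) m"
proof -
  have "{n. fps_nth (\<phi> n) m \<noteq> 0} \<subseteq> {k}"
    using assms by blast
  then have "(\<Sum>n | fps_nth (\<phi> n) m \<noteq> 0. basis_coord l q F n * fps_nth (\<phi> n) m)
      = (\<Sum>n\<in>{k}. basis_coord l q F n * fps_nth (\<phi> n) m)"
    by (intro sum.mono_neutral_left) auto
  then show ?thesis by (simp add: formal_ext_def)
qed

lemma q_pow_J0_nth:
  assumes "0 < q" "q < 1" "0 < l"
  shows "fps_nth (q_pow_J0 l q c F) m = complex_of_real (q powr (c * (l + real m))) * fps_nth F m"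
  unfolding q_pow_J0_def
  by (subst formal_ext_nth_single[where k = m])
     (use basis_coeff_pos[OF assms, of m] in \<open>auto simp: basis_fps_nth basis_coord_def split: if_splits\<close>)

lemma J_plus_nth:
  "fps_nth (J_plus l q F) m =
     (if m = 0 then 0 else
        complex_of_real (sqrt (qnum q (2 * l + real (m - 1)) * qnum q (real m))
          * basis_coeff l q m / basis_coeff l q (m - 1)) * fps_nth F (m - 1))"
  unfolding J_plus_def
  by (subst formal_ext_nth_single[where k = "m - 1"])
     (auto simp: basis_fps_nth basis_coord_def of_nat_diff split: if_splits)

lemma J_minus_nth:
  "fps_nth (J_minus l q F) m =
     complex_of_real (sqrt (qnum q (2 * l + real m) * qnum q (real m + 1))
       * basis_coeff l q m / basis_coeff l q (m + 1)) * fps_nth F (m + 1)"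
  unfolding J_minus_def
proof (subst formal_ext_nth_single[where k = "m + 1"])
  fix n
  assume *: "fps_nth (fps_const (complex_of_real
      (sqrt (qnum q (2 * l + real n - 1) * qnum q (real n)))) * basis_fps l q (n - 1)) m \<noteq> 0"
  \<comment> \<open>With truncated subtraction, n = 0 and n = 1 both point at degree 0. The factor
    \<open>qnum q 0 = 0\<close> excludes n = 0, so n = m + 1 is the only source of degree m.\<close>
  have "n \<noteq> 0"
  proof
    assume "n = 0"
    with * show False by (simp add: qnum_def)
  qed
  with * show "n = m + 1" by (auto simp: basis_fps_nth split: if_splits)
qed (auto simp: basis_fps_nth basis_coord_def add.commute)

section \<open>Matrix entries of \<open>I4\<close> with respect to the monomials\<close>

lemma qnum_eq:
  assumes "0 < q" "q < 1"
  shows "qnum q c = q powr ((1 - c) / 2) * (1 - q powr c) / (1 - q)"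
proof -
  have 1: "q powr (x / 2) - q powr (- x / 2) = - (q powr (- x / 2) * (1 - q powr x))" for x
    using assms by (simp add: algebra_simps flip: powr_add)
  have "qnum q c = (q powr (- c / 2) * (1 - q powr c)) / (q powr (- 1 / 2) * (1 - q))"
    unfolding qnum_def 1 using assms by simp
  also have "\<dots> = (q powr (- c / 2) / q powr (- 1 / 2)) * (1 - q powr c) / (1 - q)"
    by simp
  also have "q powr (- c / 2) / q powr (- 1 / 2) = q powr ((1 - c) / 2)"
    by (simp add: diff_divide_distrib flip: powr_diff)
  finally show ?thesis .
qed

lemma basis_coeff_Suc:
  assumes "0 < q"
  shows "basis_coeff l q (Suc n) = basis_coeff l q n * q powr ((1 - 2 * l) / 4)
           * sqrt ((1 - q powr (2 * l + real n)) / (1 - q ^ Suc n))"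
proof -
  have "q powr ((1 - 2 * l) * real (Suc n) / 4)
      = q powr ((1 - 2 * l) * real n / 4) * q powr ((1 - 2 * l) / 4)"
    unfolding powr_add[symmetric] by (rule arg_cong[where f = "(powr) q"]) (simp add: field_simps)
  moreover have "q powr (2 * l + real n) = q powr (2 * l) * q ^ n"
    using assms by (simp add: powr_add powr_realpow)
  ultimately show ?thesis
    by (simp add: basis_coeff_def qpoch_def flip: real_sqrt_mult)
qed

lemma sqrt_qnum:
  assumes "0 < q" "q < 1"
  shows "sqrt (qnum q (2 * l + real n) * qnum q (real n + 1)) =
           q powr ((1 - 2 * l - 2 * real n) / 4)
           * sqrt ((1 - q powr (2 * l + real n)) * (1 - q ^ Suc n)) / (1 - q)"
proof -
  have e: "q powr (real n + 1) = q ^ Suc n"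
    using assms powr_realpow[of q "Suc n"] by (simp add: add.commute)
  \<comment> \<open>The two prefactors from \<open>qnum_eq\<close> multiply to a perfect square, so
    they leave the square root as a single power of q.\<close>
  have p: "q powr ((1 - (2 * l + real n)) / 2) * q powr ((1 - (real n + 1)) / 2)
      = (q powr ((1 - 2 * l - 2 * real n) / 4))\<^sup>2"
    unfolding power2_eq_square powr_add[symmetric] by (rule arg_cong[where f = "(powr) q"]) (simp add: field_simps)
  have "qnum q (2 * l + real n) * qnum q (real n + 1) =
      (q powr ((1 - (2 * l + real n)) / 2) * q powr ((1 - (real n + 1)) / 2))
      * ((1 - q powr (2 * l + real n)) * (1 - q ^ Suc n)) / (1 - q)\<^sup>2"
    unfolding qnum_eq[OF assms] e power2_eq_square by simp
  then show ?thesis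
    unfolding p using assms by (simp add: real_sqrt_mult real_sqrt_divide)
qed

text \<open>Passing from the orthonormal basis to monomials multiplies an entry by a ratio of
  consecutive \<open>basis_coeff\<close>. With a and b the roots of 1 - q^(2l+n) and 1 - q^(n+1),
  the J entry carries a b and the ratio carries a/b or b/a, so a^2 or b^2 remains and all roots
  disappear. The two outer powers of q have the same product in both directions, since a step up and
  a step down visit the same two degrees.\<close>

lemma raising_coeff:
  assumes "0 < q" "q < 1" "0 < l"
  shows "q powr (- 1 / 4 * (l + real n)) * q powr (- 1 / 4 * (l + real (Suc n)))
           * (sqrt (qnum q (2 * l + real n) * qnum q (real n + 1))
              * basis_coeff l q (Suc n) / basis_coeff l q n)
         = q powr (1 / 4 - 3 * l / 2 - real n) * (1 - q powr (2 * l + real n)) / (1 - q)"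
    and lowering_coeff:
      "q powr (- 1 / 4 * (l + real n)) * q powr (- 1 / 4 * (l + real (Suc n)))
           * (sqrt (qnum q (2 * l + real n) * qnum q (real n + 1))
              * basis_coeff l q n / basis_coeff l q (Suc n))
         = q powr (- l / 2 - 1 / 4 - real n) * (1 - q ^ Suc n) / (1 - q)"
proof -
  define a where "a = sqrt (1 - q powr (2 * l + real n))"
  define b where "b = sqrt (1 - q ^ Suc n)"
  have "2 * l + real n > 0" using assms by simp
  then have "q powr (2 * l + real n) < 1"
    using assms by (simp add: powr_def mult_pos_neg)
  then have a: "a > 0" "1 - q powr (2 * l + real n) = a * a"
    by (auto simp: a_def)
  have "q ^ Suc n < 1"
    using assms by (intro power_Suc_less_one) auto
  then have b: "b > 0" "1 - q ^ Suc n = b * b"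
    by (auto simp: b_def)
  have c: "basis_coeff l q n > 0" by (rule basis_coeff_pos[OF assms])
  have sq: "sqrt (qnum q (2 * l + real n) * qnum q (real n + 1)) =
      q powr ((1 - 2 * l - 2 * real n) / 4) * (a * b) / (1 - q)"
    unfolding sqrt_qnum[OF assms(1,2)] a_def b_def by (simp add: real_sqrt_mult)
  have bc: "basis_coeff l q (Suc n) = basis_coeff l q n * q powr ((1 - 2 * l) / 4) * (a / b)"
    unfolding basis_coeff_Suc[OF assms(1)] a_def b_def real_sqrt_divide ..
  have up: "q powr (1 / 4 - 3 * l / 2 - real n)
      = q powr (- 1 / 4 * (l + real n)) * q powr (- 1 / 4 * (l + real (Suc n)))
        * q powr ((1 - 2 * l - 2 * real n) / 4) * q powr ((1 - 2 * l) / 4)"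
    unfolding powr_add[symmetric] by (rule arg_cong[where f = "(powr) q"]) (simp add: field_simps)
  have down: "q powr (- l / 2 - 1 / 4 - real n)
      = q powr (- 1 / 4 * (l + real n)) * q powr (- 1 / 4 * (l + real (Suc n)))
        * q powr ((1 - 2 * l - 2 * real n) / 4) / q powr ((1 - 2 * l) / 4)"
    unfolding powr_add[symmetric] powr_diff[symmetric] by (rule arg_cong[where f = "(powr) q"]) (simp add: field_simps)
  show "q powr (- 1 / 4 * (l + real n)) * q powr (- 1 / 4 * (l + real (Suc n)))
           * (sqrt (qnum q (2 * l + real n) * qnum q (real n + 1))
              * basis_coeff l q (Suc n) / basis_coeff l q n)
         = q powr (1 / 4 - 3 * l / 2 - real n) * (1 - q powr (2 * l + real n)) / (1 - q)"
    unfolding sq bc up a(2) using a(1) b(1) c by simp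
  show "q powr (- 1 / 4 * (l + real n)) * q powr (- 1 / 4 * (l + real (Suc n)))
           * (sqrt (qnum q (2 * l + real n) * qnum q (real n + 1))
              * basis_coeff l q n / basis_coeff l q (Suc n))
         = q powr (- l / 2 - 1 / 4 - real n) * (1 - q ^ Suc n) / (1 - q)"
    unfolding sq bc down b(2) using a(1) b(1) c assms(1) by (simp add: mult.commute)
qed

lemma I4_nth:
  assumes "0 < q" "q < 1" "0 < l"
  shows "fps_nth (I4 l q \<psi> F) m =
      (if m = 0 then 0 else exp (\<i> * complex_of_real \<psi>)
         * complex_of_real (q powr (5 / 4 - 3 * l / 2 - real m)
             * (1 - q powr (2 * l + real (m - 1))) / (1 - q)) * fps_nth F (m - 1))
      + exp (- \<i> * complex_of_real \<psi>)
         * complex_of_real (q powr (- l / 2 - 1 / 4 - real m) * (1 - q ^ Suc m) / (1 - q))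
         * fps_nth F (Suc m)"
proof -
  have "fps_nth (I4 l q \<psi> F) m =
      (if m = 0 then 0 else exp (\<i> * complex_of_real \<psi>)
         * complex_of_real (q powr (- 1 / 4 * (l + real (m - 1))) * q powr (- 1 / 4 * (l + real m))
             * (sqrt (qnum q (2 * l + real (m - 1)) * qnum q (real m))
                * basis_coeff l q m / basis_coeff l q (m - 1))) * fps_nth F (m - 1))
      + exp (- \<i> * complex_of_real \<psi>)
         * complex_of_real (q powr (- 1 / 4 * (l + real m)) * q powr (- 1 / 4 * (l + real (Suc m)))
             * (sqrt (qnum q (2 * l + real m) * qnum q (real m + 1))
                * basis_coeff l q m / basis_coeff l q (Suc m)))
         * fps_nth F (Suc m)"
    by (simp add: I4_def Let_def q_pow_J0_nth[OF assms] J_plus_nth J_minus_nth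
          distrib_left mult_ac)
  note this[unfolded lowering_coeff[OF assms, of m]]
  moreover have "q powr (- 1 / 4 * (l + real (m - 1))) * q powr (- 1 / 4 * (l + real m))
             * (sqrt (qnum q (2 * l + real (m - 1)) * qnum q (real m))
                * basis_coeff l q m / basis_coeff l q (m - 1))
      = q powr (5 / 4 - 3 * l / 2 - real m) * (1 - q powr (2 * l + real (m - 1))) / (1 - q)"
    if "m \<noteq> 0"
  proof -
    obtain k where m: "m = Suc k" using \<open>m \<noteq> 0\<close> by (cases m) auto
    \<comment> \<open>\<open>raising_coeff\<close> is indexed by the source degree k, the present
      statement by the target degree m = k + 1; this turns 1/4 into 5/4.\<close>
    have "1 / 4 - 3 * l / 2 - real k = 5 / 4 - 3 * l / 2 - real m" "real k + 1 = real m"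
      by (simp_all add: m)
    with raising_coeff[OF assms, of k] show ?thesis
      by (simp add: m)
  qed
  ultimately show ?thesis
    by (cases "m = 0") (simp_all only: if_True if_False not_False_eq_True simp_thms)
qed

section \<open>The recurrence for the Taylor coefficients of a quotient of q-Pochhammer
  symbols\<close>

lemma qpoch_quotient_fps:
  fixes a b c d :: complex
  assumes q: "0 < q" "q < 1"
  defines "f \<equiv> (\<lambda>x. (qpoch_inf (a * x) q * qpoch_inf (b * x) q)
                    / (qpoch_inf (c * x) q * qpoch_inf (d * x) q))"
  obtains F where "f has_fps_expansion F" "fps_nth F 0 = 1"
    "\<And>n. (1 - complex_of_real q ^ Suc n) * fps_nth F (Suc n)
        = (c + d - (a + b) * complex_of_real q ^ n) * fps_nth F n
          + (if n = 0 then 0 else (a * b * complex_of_real q ^ (n - 1) - c * d) * fps_nth F (n - 1))"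
proof -
  note an = qpoch_inf_analytic[OF q]
  \<comment> \<open>Both denominator factors equal 1 at the origin, so the quotient is analytic
    there.\<close>
  have "f analytic_on {0}"
    unfolding f_def by (intro analytic_intros an) (auto simp: qpoch_inf_0)
  then obtain F where F: "f has_fps_expansion F"
    using analytic_at_imp_has_fps_expansion_0 by blast
  have F0: "fps_nth F 0 = 1"
    using has_fps_expansion_imp_0_eq_fps_nth_0[OF F] by (simp add: f_def qpoch_inf_0)
  let ?q = "complex_of_real q"
  let ?H = "fps_compose F (fps_const ?q * fps_X)"
  \<comment> \<open>The expansion of f(q x), whose n-th coefficient is q^n times that of f.\<close>
  have "(f \<circ> (\<lambda>x. ?q * x)) has_fps_expansion ?H"
    by (intro has_fps_expansion_compose F fps_expansion_intros) auto
  then have R: "(\<lambda>x. (1 - (a + b) * x + a * b * x ^ 2) * f (?q * x))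
      has_fps_expansion (1 - fps_const (a + b) * fps_X + fps_const (a * b) * fps_X ^ 2) * ?H"
    by (intro fps_expansion_intros) (simp add: o_def)
  have L: "(\<lambda>x. (1 - (c + d) * x + c * d * x ^ 2) * f x)
      has_fps_expansion (1 - fps_const (c + d) * fps_X + fps_const (c * d) * fps_X ^ 2) * F"
    by (intro fps_expansion_intros F)
  \<comment> \<open>The functional equation is established only near 0, where (1 - c x)(1 - d x)
    does not vanish and may be cancelled. This suffices for comparing expansions.\<close>
  have "((\<lambda>x. (1 - c * x) * (1 - d * x)) \<longlongrightarrow> (1 - c * 0) * (1 - d * 0)) (nhds 0)"
    by (intro tendsto_intros filterlim_ident)
  then have "\<forall>\<^sub>F x in nhds 0. (1 - c * x) * (1 - d * x) \<noteq> 0"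
    by (rule tendsto_imp_eventually_ne) simp
  then have "\<forall>\<^sub>F x in nhds 0. (1 - (c + d) * x + c * d * x ^ 2) * f x
      = (1 - (a + b) * x + a * b * x ^ 2) * f (?q * x)"
  proof eventually_elim
    case (elim x)
    have s: "qpoch_inf (e * x) q = (1 - e * x) * qpoch_inf (e * (?q * x)) q" for e
      using qpoch_inf_shift[OF q, of "e * x"] by (simp add: mult_ac)
    have p: "1 - (u + v) * x + u * v * x ^ 2 = (1 - u * x) * (1 - v * x)" for u v
      by (simp add: algebra_simps power2_eq_square)
    \<comment> \<open>Only u v has to be nonzero: if Q or Q' vanishes, both sides are 0 because
      division by zero gives 0.\<close>
    have cancel: "u * v * ((y * P) * (z * P') / ((u * Q) * (v * Q'))) = y * z * (P * P' / (Q * Q'))"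
      if "u * v \<noteq> 0" for u v y z P P' Q Q' :: complex
      using that by simp
    show ?case
      unfolding f_def s p by (rule cancel[OF elim])
  qed
  from iffD1[OF has_fps_expansion_cong[OF this refl] L] R
  have eq: "(1 - fps_const (c + d) * fps_X + fps_const (c * d) * fps_X ^ 2) * F
      = (1 - fps_const (a + b) * fps_X + fps_const (a * b) * fps_X ^ 2) * ?H"
    by (rule fps_expansion_unique_complex)
  have nth: "fps_nth ((1 - fps_const u * fps_X + fps_const v * fps_X ^ 2) * G) (Suc n)
      = fps_nth G (Suc n) - u * fps_nth G n + (if n = 0 then 0 else v * fps_nth G (n - 1))"
    for u v :: complex and G n
    by (simp add: distrib_right left_diff_distrib mult.assoc fps_X_power_mult_nth)
  show thesis
  proof (rule that[OF F F0])
    fix n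
    show "(1 - ?q ^ Suc n) * fps_nth F (Suc n)
        = (c + d - (a + b) * ?q ^ n) * fps_nth F n
          + (if n = 0 then 0 else (a * b * ?q ^ (n - 1) - c * d) * fps_nth F (n - 1))"
      using arg_cong[OF eq, of "\<lambda>G. fps_nth G (Suc n)"]
      unfolding nth fps_nth_compose_linear by (auto simp: algebra_simps)
  qed
qed

section \<open>The eigenvalue equation in degree n as a three-term recurrence\<close>

lemma I4_eigen_iff:
  fixes q l \<psi> :: real and \<theta> lam :: complex
  assumes q: "0 < q" "q < 1" "0 < l"
    and lam: "lam = - (2 * complex_of_real (q powr (1 / 2)) * cosh \<theta> / complex_of_real (1 - q))"
  defines "E \<equiv> exp (\<i> * complex_of_real \<psi>)"
  shows "fps_nth (I4 l q \<psi> G) n = lam * fps_nth G n \<longleftrightarrow>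
    (1 - complex_of_real q ^ Suc n) * fps_nth G (Suc n) =
      - (2 * E * cosh \<theta> * complex_of_real (q powr ((2 * l + 3) / 4))) * complex_of_real q ^ n * fps_nth G n
      - (if n = 0 then 0 else E ^ 2 * complex_of_real (q powr ((3 - 2 * l) / 2)
           * (1 - q powr (2 * l + real (n - 1)))) * fps_nth G (n - 1))"
proof -
  \<comment> \<open>E times this constant is the inverse of the lowering entry stripped of its
    factor 1 - q^(n+1). Multiplying by it normalizes the coefficient of G_(n+1) to 1 - q^(n+1) and
    turns the phase of the raising term into E^2.\<close>
  define \<kappa> where "\<kappa> = q powr (l / 2 + 1 / 4 + real n) * (1 - q)"
  have \<kappa>: "\<kappa> \<noteq> 0" using q by (simp add: \<kappa>_def)
  have E: "E \<noteq> 0" "exp (- \<i> * complex_of_real \<psi>) = inverse E"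
    by (simp_all add: E_def exp_minus)
  have pu: "q powr (l / 2 + 1 / 4 + real n) * q powr (5 / 4 - 3 * l / 2 - real n)
      = q powr ((3 - 2 * l) / 2)"
    unfolding powr_add[symmetric]
    by (rule arg_cong[where f = "(powr) q"]) (simp add: field_simps)
  have pd: "q powr (l / 2 + 1 / 4 + real n) * q powr (- l / 2 - 1 / 4 - real n) = 1"
    unfolding powr_add[symmetric] using q by simp
  have pl: "q powr (l / 2 + 1 / 4 + real n) * q powr (1 / 2) = q powr ((2 * l + 3) / 4) * q ^ n"
    unfolding powr_realpow[OF q(1), symmetric] powr_add[symmetric]
    by (rule arg_cong[where f = "(powr) q"]) (simp add: field_simps)
  have up: "\<kappa> * (q powr (5 / 4 - 3 * l / 2 - real n) * x / (1 - q)) = q powr ((3 - 2 * l) / 2) * x"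
    for x using q unfolding \<kappa>_def pu[symmetric] by simp
  have down: "\<kappa> * (q powr (- l / 2 - 1 / 4 - real n) * x / (1 - q)) = x" for x
  proof -
    have "\<kappa> * (q powr (- l / 2 - 1 / 4 - real n) * x / (1 - q))
        = (q powr (l / 2 + 1 / 4 + real n) * q powr (- l / 2 - 1 / 4 - real n)) * x"
      using q by (simp add: \<kappa>_def)
    then show ?thesis unfolding pd by simp
  qed
  have "E * complex_of_real \<kappa> * lam = - (2 * E * cosh \<theta>
      * complex_of_real (q powr (l / 2 + 1 / 4 + real n) * q powr (1 / 2)))"
    using q unfolding lam \<kappa>_def by (simp add: field_simps)
  then have rhs: "E * complex_of_real \<kappa> * lam
      = - (2 * E * cosh \<theta> * complex_of_real (q powr ((2 * l + 3) / 4))) * complex_of_real q ^ n"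
    unfolding pl by simp
  have "E * complex_of_real \<kappa> * fps_nth (I4 l q \<psi> G) n
      = (if n = 0 then 0 else E ^ 2 * complex_of_real (\<kappa> * (q powr (5 / 4 - 3 * l / 2 - real n)
             * (1 - q powr (2 * l + real (n - 1))) / (1 - q))) * fps_nth G (n - 1))
      + complex_of_real (\<kappa> * (q powr (- l / 2 - 1 / 4 - real n) * (1 - q ^ Suc n) / (1 - q)))
         * fps_nth G (Suc n)"
    unfolding I4_nth[OF q] E(2) E_def[symmetric] of_real_mult[of \<kappa>]
    using E(1) by (simp add: power2_eq_square distrib_left mult_ac del: of_real_mult of_real_divide power_Suc)
  then have lhs: "E * complex_of_real \<kappa> * fps_nth (I4 l q \<psi> G) n
      = (if n = 0 then 0 else E ^ 2 * complex_of_real (q powr ((3 - 2 * l) / 2)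
             * (1 - q powr (2 * l + real (n - 1)))) * fps_nth G (n - 1))
      + (1 - complex_of_real q ^ Suc n) * fps_nth G (Suc n)"
    unfolding up down by simp
  \<comment> \<open>The multiplier is nonzero, so the two forms are equivalent. One direction
    verifies the eigenfunction, the other gives uniqueness.\<close>
  have "fps_nth (I4 l q \<psi> G) n = lam * fps_nth G n \<longleftrightarrow>
      E * complex_of_real \<kappa> * fps_nth (I4 l q \<psi> G) n
      = E * complex_of_real \<kappa> * lam * fps_nth G n"
    using E(1) \<kappa> by simp
  then show ?thesis
    unfolding lhs rhs by (simp only: eq_diff_eq add.commute)
qed

section \<open>The eigenfunction and its uniqueness up to a constant factor\<close>

theorem mainTheorem8:
  fixes q l \<psi> :: real and \<theta> lam :: complex
  assumes "0 < q" and "q < 1" and "0 < l"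
    and "lam = - (2 * complex_of_real (q powr (1 / 2)) * cosh \<theta> / complex_of_real (1 - q))"
  shows "\<exists>F :: complex fps.
           eta l q \<psi> \<theta> has_fps_expansion F
         \<and> eta l q \<psi> \<theta> 0 = 1
         \<and> I4 l q \<psi> F = fps_const lam * F
         \<and> (\<forall>G. I4 l q \<psi> G = fps_const lam * G \<longrightarrow> (\<exists>c. G = fps_const c * F))"
proof -
  define E where "E = exp (\<i> * complex_of_real \<psi>)"
  define s where "s = complex_of_real (q powr ((2 * l + 3) / 4))"
  define t where "t = complex_of_real (q powr ((3 - 2 * l) / 4))"
  define a b where "a = E * s * exp \<theta>" and "b = E * s * exp (- \<theta>)"
  define c d where "c = \<i> * E * t" and "d = - \<i> * E * t"
  note eigen_iff = I4_eigen_iff[OF assms, of \<psi>, folded E_def s_def]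
  have eta: "eta l q \<psi> \<theta> = (\<lambda>x. (qpoch_inf (a * x) q * qpoch_inf (b * x) q)
                    / (qpoch_inf (c * x) q * qpoch_inf (d * x) q))"
    by (rule ext) (simp add: eta_def a_def b_def c_def d_def E_def s_def t_def)
  obtain F where F: "eta l q \<psi> \<theta> has_fps_expansion F" and F0: "fps_nth F 0 = 1" and
    rec: "\<And>n. (1 - complex_of_real q ^ Suc n) * fps_nth F (Suc n)
        = (c + d - (a + b) * complex_of_real q ^ n) * fps_nth F n
          + (if n = 0 then 0 else (a * b * complex_of_real q ^ (n - 1) - c * d) * fps_nth F (n - 1))"
    using qpoch_quotient_fps[OF assms(1,2), of a b c d] unfolding eta by blast
  \<comment> \<open>Since d = -c, only -(a + b) q^n survives in the middle coefficient of the
    recurrence for F.\<close>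
  have cd: "c + d = 0" "c * d = E ^ 2 * complex_of_real (q powr ((3 - 2 * l) / 2))"
  proof -
    have "t * t = complex_of_real (q powr ((3 - 2 * l) / 2))"
      unfolding t_def of_real_mult[symmetric] powr_add[symmetric]
      by (intro arg_cong[where f = "\<lambda>x. complex_of_real (q powr x)"]) (simp add: field_simps)
    then show "c * d = E ^ 2 * complex_of_real (q powr ((3 - 2 * l) / 2))"
      by (simp add: c_def d_def power2_eq_square mult_ac flip: mult.assoc[of \<i> \<i>])
  qed (simp add: c_def d_def)
  have ab: "a + b = 2 * E * cosh \<theta> * s"
    by (simp add: a_def b_def cosh_field_def algebra_simps)
  \<comment> \<open>The factors exp(theta) and exp(-theta) cancel, so a b = q^(2l) c d. Hence a b
    q^(n-1) - c d = -c d (1 - q^(2l+n-1)), the last coefficient required by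
    \<open>I4_eigen_iff\<close>.\<close>
  have abq: "a * b * complex_of_real q ^ n
      = E ^ 2 * complex_of_real (q powr ((3 - 2 * l) / 2) * q powr (2 * l + real n))" for n
  proof -
    have "q powr ((2 * l + 3) / 4) * q powr ((2 * l + 3) / 4) * q ^ n
        = q powr ((3 - 2 * l) / 2) * q powr (2 * l + real n)"
      unfolding powr_realpow[OF assms(1), symmetric] powr_add[symmetric]
      by (rule arg_cong[where f = "(powr) q"]) (simp add: field_simps)
    moreover have "a * b = E ^ 2 * (s * s)"
      by (simp add: a_def b_def exp_minus power2_eq_square field_simps)
    ultimately show ?thesis
      by (simp add: s_def mult.assoc flip: of_real_mult of_real_power)
  qed
  \<comment> \<open>Once \<open>I4_eigen_iff\<close> is applied and \<open>rec\<close> inserted, the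
    two recurrences agree term by term. For n = 0 the terms with index n - 1 are absent on both
    sides.\<close>
  have "fps_nth (I4 l q \<psi> F) n = lam * fps_nth F n" for n
    unfolding eigen_iff rec cd(1) ab
    using abq[of "n - 1"] cd(2) by (simp add: algebra_simps)
  then have IF: "I4 l q \<psi> F = fps_const lam * F"
    by (simp add: fps_eq_iff)
  \<comment> \<open>As F has constant term 1, the proportionality factor can only be the constant
    term of G.\<close>
  moreover have "G = fps_const (fps_nth G 0) * F" if G: "I4 l q \<psi> G = fps_const lam * G" for G
  proof -
    have "fps_nth G n = fps_nth G 0 * fps_nth F n" for n
    proof (induction n rule: less_induct)
      case (less n)
      show ?case
      proof (cases n)
        case (Suc m)
        have "cmod (complex_of_real q ^ Suc m) < 1"
          using assms(1,2) by (simp add: norm_power norm_mult power_Suc_less_one flip: power_Suc)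
        \<comment> \<open>The leading factor of the recurrence never vanishes, so each coefficient
          is determined by its predecessors.\<close>
        then have nz: "1 - complex_of_real q ^ Suc m \<noteq> 0" by auto
        have "fps_nth (I4 l q \<psi> G) m = lam * fps_nth G m"
             "fps_nth (I4 l q \<psi> F) m = lam * fps_nth F m"
          using G IF by simp_all
        note e = this[unfolded eigen_iff]
        \<comment> \<open>For m = 0 the truncated m - 1 is 0, which is still below
          \<open>Suc m\<close>, so the induction hypothesis covers both indices.\<close>
        have ih: "fps_nth G m = fps_nth G 0 * fps_nth F m"
             "fps_nth G (m - 1) = fps_nth G 0 * fps_nth F (m - 1)"
          using less.IH[of m] less.IH[of "m - 1"] Suc by auto
        have factor: "u * (g * f) - (if P then 0 else v * (g * f'))
            = g * (u * f - (if P then 0 else v * f'))" for u v g f f' :: complex and P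
          by (simp add: algebra_simps)
        have "(1 - complex_of_real q ^ Suc m) * fps_nth G (Suc m)
            = fps_nth G 0 * ((1 - complex_of_real q ^ Suc m) * fps_nth F (Suc m))"
          unfolding e ih by (rule factor)
        then show ?thesis using nz Suc by simp
      qed (simp add: F0)
    qed
    then show ?thesis
      unfolding fps_eq_iff fps_mult_left_const_nth by blast
  qed
  moreover have "eta l q \<psi> \<theta> 0 = 1"
    by (simp add: eta_def qpoch_inf_0)
  ultimately show ?thesis using F by blast
qed

end
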